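(* Let $A\in\mathbb{R}^{m\times n}$ with $m<n$, let $x\in\mathbb{R}^n$ be a sparse vector supported on $N\subseteq[n]$ with $|N|=s$, and let $y=Ax$. Let $T\subseteq[n]$ with $|T|=k$, and let $\Delta=T^c\cap N$ with $|\Delta|=u$, where $k+u\ge 1$. Let $0\le w\le 1$. If $$\left(\sqrt{\frac{kw^2+u}{k+u}}\right)\theta_{k+u}+\delta_{k+u}+\theta_{k+u,\,2(k+u)}<1,$$ then $x$ is the unique minimizer of the problem $$\min_{z\in\mathbb{R}^n}\ \|z\|_{1,w}\quad\text{subject to}\quad Az=y .$$
   Context: Notation: $[n]=\{1,\dots,n\}$; $T^c=[n]\setminus T$; a vector $x$ is supported on $N$ if $x_i=0$ for all $i\notin N$; $\|z\|_0=|\{i: z_i\neq 0\}|$. The weighted 1-norm (with respect to the fixed set $T$ and the weight $w\in[0,1]$) is $\|z\|_{1,w}=\sum_{i=1}^n w_i|z_i|$ with $w_i=w$ for $i\in T$ and $w_i=1$ for $i\notin T$. The $j$-th restricted isometry constant $\delta_j$ of $A$ (for an integer $j<n$) is the smallest real number such that $(1-\delta_j)\|z\|_2^2\le\|Az\|_2^2\le(1+\delta_j)\|z\|_2^2$ for all $z\in\mathbb{R}^n$ with $\|z\|_0\le j$. For $S\subseteq[n]$, $A_S$ denotes the submatrix of $A$ formed by the columns with indices in $S$, and $'$ denotes transpose. For integers $p,q$ with $p+q\le n$, the restricted orthogonality constant $\theta_{p,q}$ of $A$ is the smallest real number such that $|\eta' A_S' A_{\tilde S}\tilde\eta|\le\theta_{p,q}\|\eta\|_2\|\tilde\eta\|_2$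 for all disjoint $S,\tilde S\subseteq[n]$ with $|S|\le p$, $|\tilde S|\le q$ and all $\eta\in\mathbb{R}^{|S|}$, $\tilde\eta\in\mathbb{R}^{|\tilde S|}$. One writes $\theta_p:=\theta_{p,p}$. The hypothesis is understood to include that the constants appearing in it are defined, i.e. $3(k+u)\le n$. *)

theory Defs
  imports "HOL-Analysis.Analysis"
begin

text \<open>
  The index set \<open>[n]\<close> is the finite type \<open>'n\<close>, with \<open>n = CARD('n)\<close>.
\<close>

definition supported_on :: "real ^ 'n \<Rightarrow> 'n set \<Rightarrow> bool" where
  "supported_on x N \<longleftrightarrow> (\<forall>i. i \<notin> N \<longrightarrow> x $ i = 0)"

definition norm0 :: "real ^ 'n \<Rightarrow> nat" where
  "norm0 z = card {i. z $ i \<noteq> 0}"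

definition weighted_norm1 :: "'n set \<Rightarrow> real \<Rightarrow> real ^ 'n \<Rightarrow> real" where
  "weighted_norm1 T w z = (\<Sum>i\<in>UNIV. (if i \<in> T then w else 1) * \<bar>z $ i\<bar>)"

text \<open>
  \<open>LEAST\<close> on the reals denotes the minimum only if it exists. For both constants below
  the admissible reals form a closed nonempty set; it is bounded below (by \<open>0\<close>) when
  \<open>j \<ge> 1\<close>, respectively when \<open>p, q \<ge> 1\<close> and \<open>p + q \<le> CARD('n)\<close>.
\<close>

definition restricted_isometry_const :: "real ^ 'n ^ 'm \<Rightarrow> nat \<Rightarrow> real" where
  "restricted_isometry_const A j =
    (LEAST \<delta>::real. \<forall>z. norm0 z \<le> j \<longrightarrow>
       (1 - \<delta>) * (norm z)\<^sup>2 \<le> (norm (A *v z))\<^sup>2 \<and>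
       (norm (A *v z))\<^sup>2 \<le> (1 + \<delta>) * (norm z)\<^sup>2)"

text \<open>
  \<open>submatrix_vec A S \<eta>\<close> is the product of the column submatrix \<open>A\<^sub>S\<close> with a vector indexed
  by \<open>S\<close>. Such a vector is represented by a function on all of \<open>'n\<close> whose values outside \<open>S\<close>
  are irrelevant; its Euclidean norm is \<open>L2_set \<eta> S\<close>.
\<close>

definition submatrix_vec :: "real ^ 'n ^ 'm \<Rightarrow> 'n set \<Rightarrow> ('n \<Rightarrow> real) \<Rightarrow> real ^ 'm" where
  "submatrix_vec A S \<eta> = (\<Sum>i\<in>S. \<eta> i *\<^sub>R column i A)"

text \<open>
  The bilinear form of \<open>A\<^sub>S\<close> transposed times \<open>A\<^sub>R\<close> at \<open>(\<eta>, \<zeta>)\<close> is the inner product of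
  \<open>A\<^sub>S \<eta>\<close> and \<open>A\<^sub>R \<zeta>\<close>.
\<close>

definition restricted_orthogonality_const :: "real ^ 'n ^ 'm \<Rightarrow> nat \<Rightarrow> nat \<Rightarrow> real" where
  "restricted_orthogonality_const A p q =
    (LEAST \<theta>::real. \<forall>S R. S \<inter> R = {} \<and> card S \<le> p \<and> card R \<le> q \<longrightarrow>
       (\<forall>\<eta> \<zeta>. \<bar>submatrix_vec A S \<eta> \<bullet> submatrix_vec A R \<zeta>\<bar> \<le> \<theta> * L2_set \<eta> S * L2_set \<zeta> R))"

end

theory Submission
  imports Defs
begin

text \<open>
  Suppose \<open>z = x + h\<close> is feasible and no worse than \<open>x\<close>, and put \<open>B = T \<union> \<Delta>\<close>, \<open>K = k + u = |B|\<close>.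
  Comparing the weighted norms and using Cauchy--Schwarz, the \<open>\<ell>\<^sub>1\<close> norm of \<open>h\<close> off \<open>B\<close> is at most
  \<open>\<rho> \<surd>K \<parallel>h\<^sub>B\<parallel>\<close> with \<open>\<rho> = \<surd>((k w\<^sup>2 + u) / K)\<close>. Let \<open>S\<close> be the \<open>K\<close> largest entries of \<open>h\<close> off \<open>B\<close>.
  Cutting the remaining index set \<open>R\<close> into blocks of \<open>K\<close> indices, by decreasing modulus, shows that
  \<open>|\<langle>A h\<^sub>Q, A h\<^sub>R\<rangle>| \<le> \<rho> \<theta>\<^sub>K \<parallel>h\<^sub>B\<parallel> \<parallel>h\<^sub>Q\<parallel>\<close> for \<open>Q = B\<close> and for \<open>Q = S\<close>.
  Let \<open>Q\<close> be the one of \<open>B\<close>, \<open>S\<close> on which \<open>h\<close> has the larger norm. As \<open>A h = 0\<close>, we get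
  \<open>(1 - \<delta>\<^sub>K) \<parallel>h\<^sub>Q\<parallel>\<^sup>2 \<le> \<parallel>A h\<^sub>Q\<parallel>\<^sup>2 \<le> (1 + \<rho>) \<theta>\<^sub>K \<parallel>h\<^sub>Q\<parallel>\<^sup>2\<close>. Since
  \<open>\<theta>\<^sub>K \<le> \<theta>\<^bsub>K,2K\<^esub>\<close>, the hypothesis forces \<open>h\<^sub>Q = 0\<close>, hence \<open>h\<^sub>B = 0\<close> and \<open>h = 0\<close>.
\<close>

section \<open>Attained minima on the reals and products with column submatrices\<close>

text \<open>A closed nonempty set that is bounded below contains its infimum, so
  \<open>LEAST\<close> denotes that infimum. This gives access to both restricted constants.\<close>

lemma Least_attained_real:
  fixes P :: "real \<Rightarrow> bool"
  assumes "closed {d. P d}" and "P d\<^sub>0" and lower: "\<And>d. P d \<Longrightarrow> b \<le> d"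
  shows "P (LEAST d. P d)" and "\<And>d. P d \<Longrightarrow> (LEAST d. P d) \<le> d"
proof -
  have bdd: "bdd_below {d. P d}"
    using lower by (intro bdd_belowI[of _ b]) auto
  have "Inf {d. P d} \<in> {d. P d}"
    using assms(1,2) bdd by (intro closed_contains_Inf) auto
  then have P: "P (Inf {d. P d})" by simp
  have le: "Inf {d. P d} \<le> d" if "P d" for d
    using bdd that by (intro cInf_lower) auto
  have eq: "(LEAST d. P d) = Inf {d. P d}"
    using P le by (rule Least_equality)
  show "P (LEAST d. P d)" using P eq by simp
  show "\<And>d. P d \<Longrightarrow> (LEAST d. P d) \<le> d" using le eq by simp
qed

lemma submatrix_vec_conv_matrix_vector_mult:
  "submatrix_vec A S \<eta> = A *v (\<chi> i. if i \<in> S then \<eta> i else 0)"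
proof -
  have "A *v (\<chi> i. if i \<in> S then \<eta> i else 0)
      = (\<Sum>i\<in>UNIV. if i \<in> S then \<eta> i *\<^sub>R column i A else 0)"
    unfolding matrix_mult_sum by (intro sum.cong) (auto simp: scalar_mult_eq_scaleR)
  also have "\<dots> = (\<Sum>i\<in>S. \<eta> i *\<^sub>R column i A)"
    by (simp add: sum.If_cases)
  finally show ?thesis by (simp add: submatrix_vec_def)
qed

lemma norm_restriction_eq_L2_set:
  "norm (\<chi> i. if i \<in> S then \<eta> i else (0::real)) = L2_set \<eta> (S :: 'n::finite set)"
proof -
  have "(\<Sum>i\<in>UNIV. (if i \<in> S then \<eta> i else 0)\<^sup>2) = (\<Sum>i\<in>UNIV. if i \<in> S then (\<eta> i)\<^sup>2 else 0)"
    by (intro sum.cong) auto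
  also have "\<dots> = (\<Sum>i\<in>S. (\<eta> i)\<^sup>2)" by (simp add: sum.If_cases)
  finally show ?thesis by (simp add: norm_vec_def L2_set_def)
qed

lemma submatrix_vec_union:
  "S \<inter> R = {} \<Longrightarrow> submatrix_vec A (S \<union> R) \<eta> = submatrix_vec A S \<eta> + submatrix_vec A R \<eta>"
  unfolding submatrix_vec_def by (intro sum.union_disjoint) auto

lemma matrix_vector_mult_norm_bound:
  fixes A :: "real ^ 'n ^ 'm"
  obtains C where "0 \<le> C" and "\<And>z. norm (A *v z) \<le> C * norm z"
proof -
  have bl: "bounded_linear ((*v) A)" by (rule matrix_vector_mul_bounded_linear)
  show ?thesis
    using that[OF onorm_pos_le[OF bl] onorm[OF bl]] .
qed

section \<open>Restricted isometry and orthogonality constants\<close>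

lemma restricted_isometry_lower:
  fixes A :: "real ^ 'n ^ 'm" and S :: "'n set"
  assumes "1 \<le> j" and "card S \<le> j"
  shows "(1 - restricted_isometry_const A j) * (L2_set \<eta> S)\<^sup>2 \<le> (norm (submatrix_vec A S \<eta>))\<^sup>2"
proof -
  define P where "P d \<longleftrightarrow> (\<forall>z. norm0 z \<le> j \<longrightarrow>
       (1 - d) * (norm z)\<^sup>2 \<le> (norm (A *v z))\<^sup>2 \<and>
       (norm (A *v z))\<^sup>2 \<le> (1 + d) * (norm z)\<^sup>2)" for d :: real
  obtain C where C: "0 \<le> C" "\<And>z. norm (A *v z) \<le> C * norm z"
    using matrix_vector_mult_norm_bound by blast
  have closed: "closed {d. P d}"
    unfolding P_def
    by (intro closed_Collect_all closed_Collect_imp open_Collect_const closed_Collect_conj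
        closed_Collect_le continuous_intros)
  \<comment> \<open>The summand 1 makes the factor of the lower bound nonpositive; the upper bound
    holds by the choice of \<open>C\<close>.\<close>
  have ex: "P (1 + C\<^sup>2)"
    unfolding P_def
  proof (intro allI impI conjI)
    fix z :: "real ^ 'n"
    have "(1 - (1 + C\<^sup>2)) * (norm z)\<^sup>2 \<le> 0" by (simp add: mult_nonneg_nonneg)
    then show "(1 - (1 + C\<^sup>2)) * (norm z)\<^sup>2 \<le> (norm (A *v z))\<^sup>2"
      by (meson order_trans zero_le_power2)
    have "(norm (A *v z))\<^sup>2 \<le> (C * norm z)\<^sup>2"
      using C(2) by (intro power_mono) auto
    also have "\<dots> \<le> (1 + (1 + C\<^sup>2)) * (norm z)\<^sup>2"
      by (simp add: power_mult_distrib mult_right_mono)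
    finally show "(norm (A *v z))\<^sup>2 \<le> (1 + (1 + C\<^sup>2)) * (norm z)\<^sup>2" .
  qed
  have lower: "0 \<le> d" if "P d" for d
  proof -
    fix i :: 'n
    \<comment> \<open>As \<open>1 \<le> j\<close>, a unit vector is a test vector and forces
      \<open>1 - d \<le> 1 + d\<close>.\<close>
    have "{l. axis i (1::real) $ l \<noteq> 0} = {i}" by (auto simp: axis_def)
    then have "norm0 (axis i (1::real)) \<le> j"
      using assms(1) by (simp add: norm0_def)
    then have "(1 - d) * (norm (axis i (1::real)))\<^sup>2 \<le> (1 + d) * (norm (axis i (1::real)))\<^sup>2"
      using that unfolding P_def by (meson order_trans)
    then show "0 \<le> d" by (simp add: norm_axis_1)
  qed
  have least: "P (restricted_isometry_const A j)"
    using Least_attained_real(1)[OF closed ex lower]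
    unfolding P_def restricted_isometry_const_def .
  define z where "z = (\<chi> i. if i \<in> S then \<eta> i else 0)"
  have "norm0 z \<le> card S"
    unfolding norm0_def z_def by (intro card_mono) auto
  then have "(1 - restricted_isometry_const A j) * (norm z)\<^sup>2 \<le> (norm (A *v z))\<^sup>2"
    using least assms(2) unfolding P_def by simp
  then show ?thesis
    by (simp add: z_def norm_restriction_eq_L2_set submatrix_vec_conv_matrix_vector_mult)
qed

lemma restricted_orthogonality:
  fixes A :: "real ^ 'n ^ 'm"
  assumes "1 \<le> p" and "1 \<le> q" and "p + q \<le> CARD('n)"
  shows restricted_orthogonality_nonneg: "0 \<le> restricted_orthogonality_const A p q"
    and restricted_orthogonality_bound: "\<And>S R \<eta> \<zeta>. \<lbrakk>S \<inter> R = {}; card S \<le> p; card R \<le> q\<rbrakk> \<Longrightarrow>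
      \<bar>submatrix_vec A S \<eta> \<bullet> submatrix_vec A R \<zeta>\<bar>
        \<le> restricted_orthogonality_const A p q * L2_set \<eta> S * L2_set \<zeta> R"
    and restricted_orthogonality_least: "\<And>\<theta>. (\<And>S R \<eta> \<zeta>. \<lbrakk>S \<inter> R = {}; card S \<le> p; card R \<le> q\<rbrakk> \<Longrightarrow>
      \<bar>submatrix_vec A S \<eta> \<bullet> submatrix_vec A R \<zeta>\<bar> \<le> \<theta> * L2_set \<eta> S * L2_set \<zeta> R) \<Longrightarrow>
      restricted_orthogonality_const A p q \<le> \<theta>"
proof -
  define P where "P \<theta> \<longleftrightarrow> (\<forall>S R. S \<inter> R = {} \<and> card S \<le> p \<and> card R \<le> q \<longrightarrow>
       (\<forall>\<eta> \<zeta>. \<bar>submatrix_vec A S \<eta> \<bullet> submatrix_vec A R \<zeta>\<bar> \<le> \<theta> * L2_set \<eta> S * L2_set \<zeta> R))"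
    for \<theta> :: real
  obtain C where C: "0 \<le> C" "\<And>z. norm (A *v z) \<le> C * norm z"
    using matrix_vector_mult_norm_bound by blast
  have norm_le: "norm (submatrix_vec A S \<eta>) \<le> C * L2_set \<eta> S" for S \<eta>
    using C(2) by (metis norm_restriction_eq_L2_set submatrix_vec_conv_matrix_vector_mult)
  have closed: "closed {\<theta>. P \<theta>}"
    unfolding P_def
    by (intro closed_Collect_all closed_Collect_imp open_Collect_const
        closed_Collect_le continuous_intros)
  have ex: "P (C * C)"
    unfolding P_def
  proof (intro allI impI)
    fix S R \<eta> \<zeta>
    have "\<bar>submatrix_vec A S \<eta> \<bullet> submatrix_vec A R \<zeta>\<bar>
        \<le> norm (submatrix_vec A S \<eta>) * norm (submatrix_vec A R \<zeta>)"
      by (rule Cauchy_Schwarz_ineq2)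
    also have "\<dots> \<le> (C * L2_set \<eta> S) * (C * L2_set \<zeta> R)"
      using C(1) by (intro mult_mono norm_le) (auto intro: L2_set_nonneg)
    finally show "\<bar>submatrix_vec A S \<eta> \<bullet> submatrix_vec A R \<zeta>\<bar> \<le> C * C * L2_set \<eta> S * L2_set \<zeta> R"
      by (simp add: mult_ac)
  qed
  have lower: "0 \<le> \<theta>" if "P \<theta>" for \<theta>
  proof -
    \<comment> \<open>Two distinct indices give disjoint singletons; with unit coefficients,
      \<open>\<theta>\<close> bounds an absolute value.\<close>
    have "2 \<le> CARD('n)" using assms by linarith
    then obtain U :: "'n set" where "card U = 2"
      by (metis obtain_subset_with_card_n)
    then obtain i j :: 'n where "i \<noteq> j" by (auto simp: card_2_iff)
    then have "\<bar>submatrix_vec A {i} (\<lambda>_. 1) \<bullet> submatrix_vec A {j} (\<lambda>_. 1)\<bar> \<le> \<theta>"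
      using that[unfolded P_def, rule_format, of "{i}" "{j}" "\<lambda>_. 1" "\<lambda>_. 1"] assms(1,2)
      by simp
    then show ?thesis by linarith
  qed
  have least: "P (LEAST \<theta>. P \<theta>)" "\<And>\<theta>. P \<theta> \<Longrightarrow> (LEAST \<theta>. P \<theta>) \<le> \<theta>"
    using Least_attained_real[of P, OF closed ex lower] by simp_all
  have eq: "restricted_orthogonality_const A p q = (LEAST \<theta>. P \<theta>)"
    unfolding P_def restricted_orthogonality_const_def ..
  show "0 \<le> restricted_orthogonality_const A p q"
    using lower least(1) eq by simp
  show "\<bar>submatrix_vec A S \<eta> \<bullet> submatrix_vec A R \<zeta>\<bar>
        \<le> restricted_orthogonality_const A p q * L2_set \<eta> S * L2_set \<zeta> R"
    if "S \<inter> R = {}" "card S \<le> p" "card R \<le> q" for S R \<eta> \<zeta>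
    using least(1)[folded eq, unfolded P_def, rule_format] that by simp
  show "restricted_orthogonality_const A p q \<le> \<theta>"
    if "\<And>S R \<eta> \<zeta>. \<lbrakk>S \<inter> R = {}; card S \<le> p; card R \<le> q\<rbrakk> \<Longrightarrow>
      \<bar>submatrix_vec A S \<eta> \<bullet> submatrix_vec A R \<zeta>\<bar> \<le> \<theta> * L2_set \<eta> S * L2_set \<zeta> R" for \<theta>
  proof -
    have "P \<theta>"
      unfolding P_def by (intro allI impI, elim conjE, rule that)
    then show ?thesis unfolding eq by (rule least(2))
  qed
qed

text \<open>Every pair of sets admissible for \<open>q\<close> is admissible for \<open>q'\<close>,
  so the larger constant satisfies all constraints of the smaller one.\<close>

lemma restricted_orthogonality_mono:
  fixes A :: "real ^ 'n ^ 'm"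
  assumes "1 \<le> p" and "1 \<le> q" and "q \<le> q'" and "p + q' \<le> CARD('n)"
  shows "restricted_orthogonality_const A p q \<le> restricted_orthogonality_const A p q'"
  using assms by (intro restricted_orthogonality_least restricted_orthogonality_bound) auto

section \<open>Largest entries and block sums\<close>

text \<open>Greedy choice: a maximizer of \<open>a\<close> over \<open>B - S\<close> dominates
  whatever remains after it joins \<open>S\<close>.\<close>

lemma obtain_largest_subset:
  fixes a :: "'a \<Rightarrow> 'b::linorder"
  assumes "finite B" and "K \<le> card B"
  obtains S where "S \<subseteq> B" and "card S = K" and "\<And>i j. \<lbrakk>i \<in> S; j \<in> B - S\<rbrakk> \<Longrightarrow> a j \<le> a i"
proof -
  have "\<exists>S\<subseteq>B. card S = K \<and> (\<forall>i\<in>S. \<forall>j\<in>B - S. a j \<le> a i)"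
    using assms(2)
  proof (induction K)
    case 0
    then show ?case by (intro exI[of _ "{}"]) auto
  next
    case (Suc K)
    then obtain S where S: "S \<subseteq> B" "card S = K" "\<forall>i\<in>S. \<forall>j\<in>B - S. a j \<le> a i"
      by auto
    have fin: "finite S" using S(1) assms(1) finite_subset by blast
    have "B - S \<noteq> {}"
      using S(1,2) Suc.prems by auto
    then have "Max (a ` (B - S)) \<in> a ` (B - S)"
      using assms(1) by (intro Max_in) auto
    then obtain l where l: "l \<in> B - S" "a l = Max (a ` (B - S))" by auto
    have max: "a j \<le> a l" if "j \<in> B - S" for j
      unfolding l(2) using assms(1) that by (intro Max_ge) auto
    show ?case
    proof (intro exI[of _ "insert l S"] conjI)
      show "card (insert l S) = Suc K" using l(1) S(2) fin by simp
    qed (use S l(1) max in auto)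
  qed
  then show ?thesis using that by blast
qed

lemma L2_set_le_sqrt_card:
  assumes "\<And>i. i \<in> S \<Longrightarrow> \<bar>f i\<bar> \<le> M" and "card S \<le> K" and "0 \<le> M"
  shows "L2_set f S \<le> M * sqrt (real K)"
proof -
  have "(\<Sum>i\<in>S. (f i)\<^sup>2) \<le> (\<Sum>i\<in>S. M\<^sup>2)"
  proof (rule sum_mono)
    fix i assume "i \<in> S"
    then have "\<bar>f i\<bar>\<^sup>2 \<le> M\<^sup>2" using assms(1) by (intro power_mono) auto
    then show "(f i)\<^sup>2 \<le> M\<^sup>2" by simp
  qed
  also have "\<dots> = real (card S) * M\<^sup>2" by simp
  also have "\<dots> \<le> real K * M\<^sup>2"
    using assms(2) by (intro mult_right_mono) auto
  finally have "sqrt (\<Sum>i\<in>S. (f i)\<^sup>2) \<le> sqrt (real K * M\<^sup>2)" by simp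
  then show ?thesis using assms(3) by (simp add: L2_set_def real_sqrt_mult mult.commute)
qed

text \<open>
  Bounding each block of \<open>K\<close> indices by the smallest entry of the preceding block turns
  a sum of \<open>\<ell>\<^sub>2\<close> norms into an \<open>\<ell>\<^sub>1\<close> norm, with only the first block charged to \<open>M\<close>.
\<close>

lemma abs_sum_le_of_block_bound:
  fixes f g :: "'a \<Rightarrow> real"
  assumes "finite B" and "1 \<le> K" and "0 \<le> c" and "0 \<le> M"
    and "\<And>i. i \<in> B \<Longrightarrow> \<bar>f i\<bar> \<le> M"
    and "\<And>R. \<lbrakk>R \<subseteq> B; card R \<le> K\<rbrakk> \<Longrightarrow> \<bar>\<Sum>i\<in>R. g i\<bar> \<le> c * L2_set f R"
  shows "\<bar>\<Sum>i\<in>B. g i\<bar> \<le> c * (M * sqrt (real K) + (\<Sum>i\<in>B. \<bar>f i\<bar>) / sqrt (real K))"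
  using assms(1,4-6)
\<comment> \<open>\<open>M\<close> varies because the remainder after a block has its own bound on
  the entries.\<close>
proof (induction "card B" arbitrary: B M rule: less_induct)
  case less
  have block: "\<bar>\<Sum>i\<in>R. g i\<bar> \<le> c * (M * sqrt (real K))" if "R \<subseteq> B" "card R \<le> K" for R
  proof -
    have "L2_set f R \<le> M * sqrt (real K)"
      using less.prems that by (intro L2_set_le_sqrt_card) auto
    then show ?thesis
      using less.prems(4)[OF that] assms(3) by (meson mult_left_mono order_trans)
  qed
  show ?case
  proof (cases "card B \<le> K")
    case True
    have "0 \<le> (\<Sum>i\<in>B. \<bar>f i\<bar>) / sqrt (real K)" by (intro divide_nonneg_nonneg sum_nonneg) auto
    then have "c * (M * sqrt (real K)) \<le> c * (M * sqrt (real K) + (\<Sum>i\<in>B. \<bar>f i\<bar>) / sqrt (real K))"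
      using assms(3) by (intro mult_left_mono) auto
    then show ?thesis using block[OF order_refl True] by linarith
  next
    case False
    then obtain S where S: "S \<subseteq> B" "card S = K"
      and top: "\<And>i j. \<lbrakk>i \<in> S; j \<in> B - S\<rbrakk> \<Longrightarrow> \<bar>f j\<bar> \<le> \<bar>f i\<bar>"
      using obtain_largest_subset[of B K "\<lambda>i. \<bar>f i\<bar>"] less.prems(1) by auto
    have fin: "finite S" using S(1) less.prems(1) finite_subset by blast
    have ne: "S \<noteq> {}" using S(2) assms(2) by auto
    define m where "m = (MIN i\<in>S. \<bar>f i\<bar>)"
    have m_le: "m \<le> \<bar>f i\<bar>" if "i \<in> S" for i
      unfolding m_def using fin that by (intro Min_le) auto
    have m_ge: "\<bar>f j\<bar> \<le> m" if "j \<in> B - S" for j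
      unfolding m_def using fin ne top that by (intro Min.boundedI) auto
    have m_nonneg: "0 \<le> m"
      unfolding m_def using fin ne by (intro Min.boundedI) auto
    have "card (B - S) < card B"
      using S ne less.prems(1) by (intro psubset_card_mono) auto
    then have rest: "\<bar>\<Sum>i\<in>B - S. g i\<bar>
        \<le> c * (m * sqrt (real K) + (\<Sum>i\<in>B - S. \<bar>f i\<bar>) / sqrt (real K))"
      using less.prems(1,4) m_ge m_nonneg by (intro less.hyps) auto
    \<comment> \<open>The term \<open>m * sqrt (real K)\<close> produced by the remainder is paid
      for by the mass of \<open>f\<close> on \<open>S\<close>.\<close>
    have "real K * m \<le> (\<Sum>i\<in>S. \<bar>f i\<bar>)"
      using sum_mono[of S "\<lambda>_. m" "\<lambda>i. \<bar>f i\<bar>"] m_le S(2) by simp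
    then have "m * sqrt (real K) \<le> (\<Sum>i\<in>S. \<bar>f i\<bar>) / sqrt (real K)"
      using assms(2) by (simp add: pos_le_divide_eq mult.commute mult.left_commute)
    moreover have sum_f: "(\<Sum>i\<in>B. \<bar>f i\<bar>) = (\<Sum>i\<in>B - S. \<bar>f i\<bar>) + (\<Sum>i\<in>S. \<bar>f i\<bar>)"
      using S(1) less.prems(1) by (rule sum.subset_diff)
    ultimately have "m * sqrt (real K) + (\<Sum>i\<in>B - S. \<bar>f i\<bar>) / sqrt (real K)
        \<le> (\<Sum>i\<in>B. \<bar>f i\<bar>) / sqrt (real K)"
      by (simp add: add_divide_distrib)
    then have "\<bar>\<Sum>i\<in>B - S. g i\<bar> \<le> c * ((\<Sum>i\<in>B. \<bar>f i\<bar>) / sqrt (real K))"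
      using rest assms(3) by (meson mult_left_mono order_trans)
    moreover have "\<bar>\<Sum>i\<in>S. g i\<bar> \<le> c * (M * sqrt (real K))"
      using block S by simp
    moreover have "(\<Sum>i\<in>B. g i) = (\<Sum>i\<in>B - S. g i) + (\<Sum>i\<in>S. g i)"
      using S(1) less.prems(1) by (rule sum.subset_diff)
    ultimately show ?thesis
      unfolding distrib_left by linarith
  qed
qed

section \<open>Null vectors satisfying the cone condition\<close>

text \<open>The bound \<open>2 * card B \<le> CARD('n)\<close> leaves room outside \<open>B\<close>
  for a block \<open>S\<close> of equal size. Testing \<open>A *v h = 0\<close> against the heavier
  of the two blocks contradicts \<open>small\<close> unless that block vanishes.\<close>

lemma null_vector_restriction_eq_0:
  fixes A :: "real ^ 'n ^ 'm" and h :: "real ^ 'n" and B :: "'n set"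
  defines "\<theta> \<equiv> restricted_orthogonality_const A (card B) (card B)"
  assumes null: "A *v h = 0"
    and K: "1 \<le> card B" "2 * card B \<le> CARD('n)"
    and rho: "0 \<le> \<rho>"
    and cone: "(\<Sum>i\<in>- B. \<bar>h $ i\<bar>) \<le> \<rho> * sqrt (real (card B)) * L2_set (($) h) B"
    and small: "(1 + \<rho>) * \<theta> + restricted_isometry_const A (card B) < 1"
  shows "L2_set (($) h) B = 0"
proof -
  define K where "K = card B"
  define V where "V S = submatrix_vec A S (($) h)" for S
  define l where "l S = L2_set (($) h) S" for S
  have l_nonneg: "0 \<le> l S" for S by (simp add: l_def L2_set_nonneg)
  have theta_nonneg: "0 \<le> \<theta>"
    unfolding \<theta>_def using K by (intro restricted_orthogonality_nonneg) auto
  have orth: "\<bar>V S \<bullet> V R\<bar> \<le> \<theta> * l S * l R"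
    if "S \<inter> R = {}" "card S \<le> K" "card R \<le> K" for S R
    unfolding V_def l_def \<theta>_def
    using K that by (intro restricted_orthogonality_bound) (auto simp: K_def)
  have V_Un: "V (S \<union> R) = V S + V R" if "S \<inter> R = {}" for S R
    unfolding V_def using that by (rule submatrix_vec_union)
  have "card (- B) = CARD('n) - K" by (simp add: Compl_eq_Diff_UNIV card_Diff_subset K_def)
  then have "K \<le> card (- B)" using K by (simp add: K_def)
  then obtain S where S: "S \<subseteq> - B" "card S = K"
    and top: "\<And>i j. \<lbrakk>i \<in> S; j \<in> - B - S\<rbrakk> \<Longrightarrow> \<bar>h $ j\<bar> \<le> \<bar>h $ i\<bar>"
    using obtain_largest_subset[of "- B" K "\<lambda>i. \<bar>h $ i\<bar>"] by auto
  have ne: "S \<noteq> {}" using S(2) K(1) by (auto simp: K_def)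
  define m where "m = (MIN i\<in>S. \<bar>h $ i\<bar>)"
  have m_le: "m \<le> \<bar>h $ i\<bar>" if "i \<in> S" for i
    unfolding m_def using that by (intro Min_le) auto
  have m_ge: "\<bar>h $ j\<bar> \<le> m" if "j \<in> - B - S" for j
    unfolding m_def using ne top that by (intro Min.boundedI) auto
  have m_nonneg: "0 \<le> m"
    unfolding m_def using ne by (intro Min.boundedI) auto
  define R where "R = - B - S"
  have K_pos: "0 < sqrt (real K)" using K(1) by (simp add: K_def)
  \<comment> \<open>The mass on \<open>S\<close> pays for the first block of \<open>R\<close>, whose
    entries are at most \<open>m\<close>. Hence the whole tail costs no more than the mass off
    \<open>B\<close>.\<close>
  have "real K * m \<le> (\<Sum>i\<in>S. \<bar>h $ i\<bar>)"
    using sum_mono[of S "\<lambda>_. m" "\<lambda>i. \<bar>h $ i\<bar>"] m_le S(2) by simp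
  moreover have "(\<Sum>i\<in>- B. \<bar>h $ i\<bar>) = (\<Sum>i\<in>R. \<bar>h $ i\<bar>) + (\<Sum>i\<in>S. \<bar>h $ i\<bar>)"
    unfolding R_def using S(1) by (intro sum.subset_diff) auto
  ultimately have "real K * m + (\<Sum>i\<in>R. \<bar>h $ i\<bar>) \<le> \<rho> * sqrt (real K) * l B"
    using cone by (simp add: K_def l_def)
  then have "(real K * m + (\<Sum>i\<in>R. \<bar>h $ i\<bar>)) / sqrt (real K) \<le> \<rho> * l B"
    using K_pos by (simp add: pos_divide_le_eq mult_ac)
  then have tail_le: "m * sqrt (real K) + (\<Sum>i\<in>R. \<bar>h $ i\<bar>) / sqrt (real K) \<le> \<rho> * l B"
    by (simp add: add_divide_distrib real_div_sqrt mult.commute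
        flip: times_divide_eq_right)
  have tail: "\<bar>V Q \<bullet> V R\<bar> \<le> \<theta> * l Q * (\<rho> * l B)" if Q: "Q \<inter> R = {}" "card Q \<le> K" for Q
  proof -
    \<comment> \<open>Written as a sum over indices, the inner product can be cut into blocks, each
      controlled by \<open>orth\<close>.\<close>
    have V_sum: "V Q \<bullet> V P = (\<Sum>i\<in>P. V Q \<bullet> (h $ i *\<^sub>R column i A))" for P
      by (simp add: V_def[of P] submatrix_vec_def inner_sum_right)
    have "\<bar>V Q \<bullet> V R\<bar>
        \<le> \<theta> * l Q * (m * sqrt (real K) + (\<Sum>i\<in>R. \<bar>h $ i\<bar>) / sqrt (real K))"
      unfolding V_sum
    proof (rule abs_sum_le_of_block_bound)
      show "\<bar>\<Sum>i\<in>P. V Q \<bullet> (h $ i *\<^sub>R column i A)\<bar> \<le> \<theta> * l Q * L2_set (($) h) P"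
        if "P \<subseteq> R" "card P \<le> K" for P
        using orth[of Q P] Q that unfolding V_sum l_def by blast
    qed (use K(1) theta_nonneg l_nonneg m_nonneg m_ge in \<open>auto simp: K_def R_def\<close>)
    also have "\<dots> \<le> \<theta> * l Q * (\<rho> * l B)"
      using tail_le theta_nonneg l_nonneg by (intro mult_left_mono) auto
    finally show ?thesis .
  qed
  have "V UNIV = 0"
    using null by (simp add: V_def submatrix_vec_conv_matrix_vector_mult)
  moreover have "(B \<union> S) \<union> R = UNIV" "(B \<union> S) \<inter> R = {}" "B \<inter> S = {}"
    using S(1) by (auto simp: R_def)
  ultimately have V_0: "V B + V S + V R = 0"
    using V_Un[of "B \<union> S" R] V_Un[of B S] by simp
  \<comment> \<open>Stated for \<open>Q\<close> and \<open>P\<close> so that \<open>B\<close> and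
    \<open>S\<close> can take either role. The tail bound involves \<open>l B\<close> whichever
    block is \<open>Q\<close>, hence the second comparison in \<open>le\<close>.\<close>
  have zero: "l Q = 0"
    if Q: "Q \<inter> P = {}" "Q \<inter> R = {}" "card Q = K" "card P = K"
      and V: "V Q + V P + V R = 0" and le: "l P \<le> l Q" "l B \<le> l Q" for Q P
  proof (rule ccontr)
    assume "l Q \<noteq> 0"
    then have pos: "0 < l Q * l Q" using l_nonneg[of Q] by simp
    have "V Q \<bullet> V Q + V Q \<bullet> V P + V Q \<bullet> V R = 0"
      using V by (metis inner_add_right inner_zero_right)
    then have "(norm (V Q))\<^sup>2 \<le> \<bar>V Q \<bullet> V P\<bar> + \<bar>V Q \<bullet> V R\<bar>"
      unfolding power2_norm_eq_inner by linarith
    also have "\<dots> \<le> \<theta> * l Q * l P + \<theta> * l Q * (\<rho> * l B)"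
      using orth[of Q P] tail[of Q] Q by simp
    also have "\<dots> \<le> \<theta> * l Q * l Q + \<theta> * l Q * (\<rho> * l Q)"
      using le rho theta_nonneg l_nonneg by (intro add_mono mult_left_mono) auto
    also have "\<dots> = (1 + \<rho>) * \<theta> * (l Q * l Q)" by (simp add: algebra_simps)
    also have "\<dots> < (1 - restricted_isometry_const A K) * (l Q * l Q)"
      using small pos by (intro mult_strict_right_mono) (auto simp: K_def)
    also have "\<dots> \<le> (norm (V Q))\<^sup>2"
      using restricted_isometry_lower[of K Q A "($) h"] K(1) Q(3)
      by (simp add: V_def l_def K_def power2_eq_square)
    finally show False by simp
  qed
  have "l B = 0"
  proof (cases "l S \<le> l B")
    case True
    then show ?thesis
      using S V_0 by (intro zero[of B S]) (auto simp: R_def K_def)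
  next
    case False
    \<comment> \<open>This is incompatible with \<open>l B < l S\<close>, as \<open>l B\<close> is
      nonnegative.\<close>
    then have "l S = 0"
      using S V_0 by (intro zero[of S B]) (auto simp: R_def K_def add_ac)
    then show ?thesis using False l_nonneg[of B] by simp
  qed
  then show ?thesis by (simp add: l_def)
qed

section \<open>Weighted norm descent and unique minimality\<close>

text \<open>On \<open>B\<close> the triangle inequality limits the decrease at \<open>i\<close> to
  \<open>c i\<close> times the change. Off \<open>B\<close> the weight is 1 and \<open>x\<close>
  vanishes, so the change is pure increase. Cauchy-Schwarz against the weights on \<open>B\<close>
  yields the square root.\<close>

lemma weighted_norm1_descent_cone:
  fixes x z :: "real ^ 'n" and T B :: "'n set"
  assumes "supported_on x B" and "T \<subseteq> B" and "0 \<le> w"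
    and "weighted_norm1 T w z \<le> weighted_norm1 T w x"
  shows "(\<Sum>i\<in>- B. \<bar>(z - x) $ i\<bar>)
    \<le> sqrt (real (card T) * w\<^sup>2 + real (card (B - T))) * L2_set (($) (z - x)) B"
proof -
  define c where "c i = (if i \<in> T then w else 1)" for i
  have "(\<Sum>i\<in>UNIV. (if i \<in> B then - c i * \<bar>(z - x) $ i\<bar> else \<bar>(z - x) $ i\<bar>))
      \<le> (\<Sum>i\<in>UNIV. c i * \<bar>z $ i\<bar> - c i * \<bar>x $ i\<bar>)"
  proof (rule sum_mono)
    fix i
    have "- (c i * \<bar>(z - x) $ i\<bar>) \<le> c i * (\<bar>z $ i\<bar> - \<bar>x $ i\<bar>)"
      unfolding mult_minus_right[symmetric]
      using assms(3) by (intro mult_left_mono) (auto simp: c_def)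
    then show "(if i \<in> B then - c i * \<bar>(z - x) $ i\<bar> else \<bar>(z - x) $ i\<bar>)
        \<le> c i * \<bar>z $ i\<bar> - c i * \<bar>x $ i\<bar>"
      using assms(1,2) by (auto simp: c_def supported_on_def right_diff_distrib)
  qed
  also have "\<dots> \<le> 0"
    using assms(4) by (simp add: weighted_norm1_def c_def sum_subtractf)
  finally have "(\<Sum>i\<in>- B. \<bar>(z - x) $ i\<bar>) \<le> (\<Sum>i\<in>B. c i * \<bar>(z - x) $ i\<bar>)"
    by (simp add: sum.If_cases Collect_neg_eq[symmetric] sum_negf Compl_eq)
  also have "\<dots> = (\<Sum>i\<in>B. \<bar>c i\<bar> * \<bar>(z - x) $ i\<bar>)"
    using assms(3) by (intro sum.cong) (auto simp: c_def)
  also have "\<dots> \<le> L2_set c B * L2_set (($) (z - x)) B"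
    by (rule L2_set_mult_ineq)
  also have "(\<Sum>i\<in>B. (c i)\<^sup>2) = (\<Sum>i\<in>B - T. (c i)\<^sup>2) + (\<Sum>i\<in>T. (c i)\<^sup>2)"
    using assms(2) by (intro sum.subset_diff) auto
  then have "L2_set c B = sqrt (real (card T) * w\<^sup>2 + real (card (B - T)))"
    by (simp add: L2_set_def c_def add.commute)
  finally show ?thesis .
qed

theorem theorem9:
  fixes A :: "real ^ 'n ^ 'm"
    and x :: "real ^ 'n" and y :: "real ^ 'm"
    and N T \<Delta> :: "'n set"
    and s k u :: nat and w :: real
  assumes "CARD('m) < CARD('n)"
    and "supported_on x N" and "card N = s"
    and "y = A *v x"
    and "card T = k"
    and "\<Delta> = (- T) \<inter> N" and "card \<Delta> = u"
    and "k + u \<ge> 1"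
    and "0 \<le> w" and "w \<le> 1"
    and "3 * (k + u) \<le> CARD('n)"
    and "sqrt ((real k * w\<^sup>2 + real u) / real (k + u))
           * restricted_orthogonality_const A (k + u) (k + u)
         + restricted_isometry_const A (k + u)
         + restricted_orthogonality_const A (k + u) (2 * (k + u)) < 1"
  shows "is_arg_min (weighted_norm1 T w) (\<lambda>z. A *v z = y) x \<and>
         (\<forall>z. is_arg_min (weighted_norm1 T w) (\<lambda>z. A *v z = y) z \<longrightarrow> z = x)"
proof -
  define B where "B = T \<union> \<Delta>"
  define K where "K = k + u"
  define \<rho> where "\<rho> = sqrt ((real k * w\<^sup>2 + real u) / real K)"
  have diff: "B - T = \<Delta>" and sub: "T \<subseteq> B" using assms(6) by (auto simp: B_def)
  have card_B: "card B = K"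
    using assms(5-7) by (simp add: B_def K_def card_Un_disjoint Int_assoc[symmetric])
  have supp: "supported_on x B"
    using assms(2,6) by (auto simp: supported_on_def B_def)
  have K: "1 \<le> K" "3 * K \<le> CARD('n)" using assms(8,11) by (auto simp: K_def)
  have rho: "0 \<le> \<rho>" by (simp add: \<rho>_def)
  \<comment> \<open>Puts the descent factor into the normalization of the cone condition.\<close>
  have rho_K: "sqrt (real k * w\<^sup>2 + real u) = \<rho> * sqrt (real K)"
    using K(1) by (simp add: \<rho>_def real_sqrt_divide)
  \<comment> \<open>Supplies the summand 1 in the factor \<open>1 + \<rho>\<close>.\<close>
  have "restricted_orthogonality_const A K K \<le> restricted_orthogonality_const A K (2 * K)"
    using K by (intro restricted_orthogonality_mono) auto
  then have small: "(1 + \<rho>) * restricted_orthogonality_const A K K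
      + restricted_isometry_const A K < 1"
    using assms(12) by (simp add: \<rho>_def K_def algebra_simps)
  have unique: "z = x" if "A *v z = y" and "weighted_norm1 T w z \<le> weighted_norm1 T w x" for z
  proof -
    have cone: "(\<Sum>i\<in>- B. \<bar>(z - x) $ i\<bar>) \<le> \<rho> * sqrt (real K) * L2_set (($) (z - x)) B"
      using weighted_norm1_descent_cone[OF supp sub assms(9) that(2)] assms(5,7) rho_K
      by (simp add: diff)
    have zero: "L2_set (($) (z - x)) B = 0"
    proof (rule null_vector_restriction_eq_0[where A = A and \<rho> = \<rho>])
      show "A *v (z - x) = 0"
        using that(1) assms(4) by (simp add: matrix_vector_mult_diff_distrib)
    qed (use K rho cone small in \<open>auto simp: card_B\<close>)
    \<comment> \<open>With no mass on \<open>B\<close>, the cone condition leaves none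
      outside.\<close>
    then have "(\<Sum>i\<in>- B. \<bar>(z - x) $ i\<bar>) = 0"
      using cone by (intro antisym) (auto intro: sum_nonneg)
    then have "(z - x) $ i = 0" if "i \<notin> B" for i
      using that by (simp add: sum_nonneg_eq_0_iff)
    moreover have "(z - x) $ i = 0" if "i \<in> B" for i
      using zero that by (simp add: L2_set_eq_0_iff)
    ultimately show "z = x" by (simp add: vec_eq_iff) blast
  qed
  have "is_arg_min (weighted_norm1 T w) (\<lambda>z. A *v z = y) x"
    unfolding is_arg_min_def using unique assms(4) by force
  moreover have "z = x" if "is_arg_min (weighted_norm1 T w) (\<lambda>z. A *v z = y) z" for z
    using that unique assms(4) by (simp add: is_arg_min_linorder)
  ultimately show ?thesis by blast
qed

end
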